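(* Let $p$ be a prime, let $G$ be an abelian $p$-group and let $H=\bigoplus_{i=1}^n H_i$ be a finite subgroup of $G$ such that all $H_i$ are cyclic groups. The following are equivalent: (1) $H\in\mathcal{Q}(G)$; (2) (a) $H_i\in\mathcal{Q}(G)$ for all $i=1,\dots,n$, and (b) $H=\bigoplus_{i=1}^n H_i$ is a valuated direct sum of cyclic groups.
   Context: All groups are abelian; $p$ is a fixed prime. $\mathcal{Q}(G)$ is the set of subgroups $N\le G$ such that every homomorphism $N\to G$ extends to an endomorphism of $G$. For $x\in G$, $h(x)$ denotes the (generalized, ordinal-valued) $p$-height of $x$ in $G$: $h(x)=\sigma$ if $x\in p^\sigma G\setminus p^{\sigma+1}G$, and $h(x)=\infty$ if $x$ lies in the divisible part of $G$. A subgroup $H\le G$ carries the valuation $v(x)=h(x)$ induced by heights in $G$. A direct sum $H=K\oplus L$ is a valuated direct sum if $v(k+\ell)=\min\{v(k),v(\ell)\}$ for all $k\in K$, $\ell\in L$; similarly $H=\bigoplus_{i=1}^n H_i$ is a valuated direct sum if $v(x_1+\dots+x_n)=\min_i v(x_i)$ for all $x_i\in H_i$. *)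

theory Defs
  imports "HOL-Algebra.Multiplicative_Group" "HOL-Algebra.Elementary_Groups" "HOL-Computational_Algebra.Primes" "HOL-Number_Theory.Cong"
begin

section \<open>Ordinals indexing the transfinite p-powers of a group\<close>

text \<open>
  For a group whose elements have type \<open>'a\<close>, the ordinals below the cardinal successor of
  \<open>|'a + nat|\<close> suffice: they form a limit ordinal, and there are too many of them for a strictly
  decreasing chain of subgroups to be indexed by all of them (see \<open>ppow_stabilises\<close>).
\<close>

lemma card_suc_Well_order:
  "well_order_on UNIV (card_suc (card_of (UNIV :: 'a set)))"
  using card_order_card_suc[OF card_of_card_order_on] unfolding card_order_on_def by blast

instantiation suc :: (type) linorder
begin

definition less_eq_suc :: "'a suc \<Rightarrow> 'a suc \<Rightarrow> bool" where
  "x \<le> y \<longleftrightarrow> (x, y) \<in> card_suc (card_of (UNIV :: 'a set))"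

definition less_suc :: "'a suc \<Rightarrow> 'a suc \<Rightarrow> bool" where
  "x < y \<longleftrightarrow> (x, y) \<in> card_suc (card_of (UNIV :: 'a set)) - Id"

instance
proof
  let ?r = "card_suc (card_of (UNIV :: 'a set))"
  have r: "refl ?r" "trans ?r" "antisym ?r" "total ?r"
    using card_suc_Well_order[where ?'a = 'a]
    unfolding well_order_on_def linear_order_on_def partial_order_on_def preorder_on_def
    by simp_all
  fix x y z :: "'a suc"
  show "(x < y) = (x \<le> y \<and> \<not> y \<le> x)"
    using antisymD[OF r(3), of x y] reflD[OF r(1), of x]
    unfolding less_eq_suc_def less_suc_def by auto
  show "x \<le> x"
    using reflD[OF r(1)] unfolding less_eq_suc_def .
  show "x \<le> y \<Longrightarrow> y \<le> z \<Longrightarrow> x \<le> z"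
    using transD[OF r(2)] unfolding less_eq_suc_def .
  show "x \<le> y \<Longrightarrow> y \<le> x \<Longrightarrow> x = y"
    using antisymD[OF r(3)] unfolding less_eq_suc_def .
  show "x \<le> y \<or> y \<le> x"
    using r(4) reflD[OF r(1), of x] unfolding less_eq_suc_def total_on_def
    by (cases "x = y") auto
qed

end

instance suc :: (type) wellorder
proof (rule wf_wellorderI)
  have "{(x, y :: 'a suc). x < y} = card_suc (card_of (UNIV :: 'a set)) - Id"
    by (auto simp: less_suc_def)
  thus "wf {(x, y :: 'a suc). x < y}"
    using card_suc_Well_order[where ?'a = 'a] unfolding well_order_on_def by (simp only:)
qed intro_classes

type_synonym 'a ordinal = "('a + nat) suc"

definition osuc :: "'a ordinal \<Rightarrow> 'a ordinal" where
  "osuc \<sigma> = (LEAST \<tau>. \<sigma> < \<tau>)"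

lemma ordinal_no_max: "\<exists>\<tau>. (\<sigma> :: 'a ordinal) < \<tau>"
proof -
  let ?r = "card_suc (card_of (UNIV :: ('a + nat) set))"
  have co: "card_order (card_of (UNIV :: ('a + nat) set))"
    by (rule card_of_card_order_on)
  have C: "Card_order ?r" by (rule Card_order_card_suc[OF co])
  have F: "Field ?r = UNIV" by (rule Field_card_suc)
  have "(card_of (UNIV :: ('a + nat) set), ?r) \<in> ordLess" by (rule card_suc_greater[OF co])
  hence "(card_of (UNIV :: ('a + nat) set), card_of (Field ?r)) \<in> ordLeq"
    using card_of_Field_ordIso[OF C] ordIso_symmetric ordLess_imp_ordLeq ordLeq_ordIso_trans
    by blast
  moreover have "infinite (UNIV :: ('a + nat) set)" by (simp add: finite_Plus_UNIV_iff)
  ultimately have "infinite (Field ?r)" using card_of_ordLeq_infinite by blast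
  moreover have "\<sigma> \<in> Field ?r" unfolding F by (rule UNIV_I)
  ultimately obtain \<tau> where "\<sigma> \<noteq> \<tau>" "(\<sigma>, \<tau>) \<in> ?r"
    using infinite_Card_order_limit[OF C] by metis
  hence "\<sigma> < \<tau>" by (simp add: less_suc_def)
  thus ?thesis ..
qed

lemma less_osuc: "(\<sigma> :: 'a ordinal) < osuc \<sigma>"
  unfolding osuc_def by (rule LeastI_ex[OF ordinal_no_max])

lemma osuc_le_iff: "osuc \<sigma> \<le> \<tau> \<longleftrightarrow> (\<sigma> :: 'a ordinal) < \<tau>"
proof
  show "\<sigma> < \<tau>" if "osuc \<sigma> \<le> \<tau>"
    using less_osuc[of \<sigma>] that by (rule less_le_trans)
  show "osuc \<sigma> \<le> \<tau>" if "\<sigma> < \<tau>"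
    unfolding osuc_def using that by (rule Least_le)
qed

lemma osuc_inject [simp]: "osuc \<sigma> = osuc \<tau> \<longleftrightarrow> (\<sigma> :: 'a ordinal) = \<tau>"
proof
  assume eq: "osuc \<sigma> = osuc \<tau>"
  show "\<sigma> = \<tau>"
  proof (rule antisym; rule leI; rule notI)
    assume "\<tau> < \<sigma>"
    hence "osuc \<tau> \<le> \<sigma>" by (simp only: osuc_le_iff)
    thus False using less_osuc[of \<sigma>] unfolding eq by order
  next
    assume "\<sigma> < \<tau>"
    hence "osuc \<sigma> \<le> \<tau>" by (simp only: osuc_le_iff)
    thus False using less_osuc[of \<tau>] unfolding eq[symmetric] by order
  qed
qed simp

lemma the_osuc [simp]: "(THE \<rho>. osuc \<sigma> = osuc \<rho>) = (\<sigma> :: 'a ordinal)"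
  by (rule the_equality) auto

lemma no_inj_ordinal: "\<not> inj (f :: 'a ordinal \<Rightarrow> 'a)"
proof
  assume "inj f"
  hence "inj (\<lambda>\<sigma>. Inl (f \<sigma>) :: 'a + nat)"
    by (auto simp: inj_def)
  hence "(card_of (UNIV :: 'a ordinal set), card_of (UNIV :: ('a + nat) set)) \<in> ordLeq"
    using card_of_ordLeq by blast
  moreover have co: "card_order (card_of (UNIV :: ('a + nat) set))"
    by (rule card_of_card_order_on)
  have "(card_suc (card_of (UNIV :: ('a + nat) set)), card_of (UNIV :: 'a ordinal set)) \<in> ordIso"
    using card_of_Field_ordIso[OF Card_order_card_suc[OF co]] ordIso_symmetric
    unfolding Field_card_suc by blast
  ultimately show False
    using card_suc_greater[OF co] ordIso_ordLeq_trans not_ordLess_ordLeq by blast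
qed


section \<open>Heights\<close>

text \<open>
  Groups are written multiplicatively, so multiplication by \<open>p\<close> is the map \<open>y \<mapsto> y [^] p\<close>.
  The second branch covers zero (empty intersection, giving the whole group) and limit ordinals.
\<close>

function ppow :: "nat \<Rightarrow> ('a, 'b) monoid_scheme \<Rightarrow> 'a ordinal \<Rightarrow> 'a set" where
  "ppow p G \<sigma> =
    (if \<exists>\<rho>. \<sigma> = osuc \<rho> then (\<lambda>y. y [^]\<^bsub>G\<^esub> p) ` ppow p G (THE \<rho>. \<sigma> = osuc \<rho>)
     else carrier G \<inter> (\<Inter>\<tau>\<in>{..<\<sigma>}. ppow p G \<tau>))"
  by auto
termination
proof (relation "inv_image {(x, y :: 'a ordinal). x < y} (\<lambda>(p, G, \<sigma>). \<sigma>)")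
  show "wf (inv_image {(x, y :: 'a ordinal). x < y} (\<lambda>(p, G, \<sigma>). \<sigma>))"
    by (simp add: wf)
qed (auto simp: less_osuc)

declare ppow.simps [simp del]

lemma ppow_osuc: "ppow p G (osuc \<sigma>) = (\<lambda>y. y [^]\<^bsub>G\<^esub> p) ` ppow p G \<sigma>"
  by (subst ppow.simps) auto

lemma ppow_limit:
  assumes "\<nexists>\<rho>. \<sigma> = osuc \<rho>"
  shows "ppow p G \<sigma> = carrier G \<inter> (\<Inter>\<tau>\<in>{..<\<sigma>}. ppow p G \<tau>)"
  using assms by (subst ppow.simps) auto

definition divisible_group :: "('a, 'b) monoid_scheme \<Rightarrow> bool" where
  "divisible_group G \<longleftrightarrow>
    (\<forall>n::nat. 0 < n \<longrightarrow> (\<forall>x\<in>carrier G. \<exists>y\<in>carrier G. y [^]\<^bsub>G\<^esub> n = x))"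

definition divisible_part :: "('a, 'b) monoid_scheme \<Rightarrow> 'a set" where
  "divisible_part G =
    generate G (\<Union>{D. subgroup D G \<and> divisible_group (G\<lparr>carrier := D\<rparr>)})"

datatype 'a height = Height "'a ordinal" | Infty

instantiation height :: (type) linorder
begin

fun less_eq_height :: "'a height \<Rightarrow> 'a height \<Rightarrow> bool" where
  "Height \<sigma> \<le> Height \<tau> \<longleftrightarrow> \<sigma> \<le> \<tau>"
| "Infty \<le> Height \<tau> \<longleftrightarrow> False"
| "_ \<le> Infty \<longleftrightarrow> True"

definition less_height :: "'a height \<Rightarrow> 'a height \<Rightarrow> bool" where
  "x < y \<longleftrightarrow> x \<le> y \<and> \<not> y \<le> x" for x y :: "'a height"

instance
proof
  fix x y z :: "'a height"
  show "(x < y) = (x \<le> y \<and> \<not> y \<le> x)" by (rule less_height_def)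
  show "x \<le> x" by (cases x) auto
  show "x \<le> y \<Longrightarrow> y \<le> z \<Longrightarrow> x \<le> z" by (cases x; cases y; cases z) auto
  show "x \<le> y \<Longrightarrow> y \<le> x \<Longrightarrow> x = y" by (cases x; cases y) auto
  show "x \<le> y \<or> y \<le> x" by (cases x; cases y) auto
qed

end

definition pheight :: "nat \<Rightarrow> ('a, 'b) monoid_scheme \<Rightarrow> 'a \<Rightarrow> 'a height" where
  "pheight p G x =
    (if x \<in> divisible_part G then Infty
     else Height (THE \<sigma>. x \<in> ppow p G \<sigma> - ppow p G (osuc \<sigma>)))"


section \<open>Subgroups and direct sums\<close>

definition p_primary_group :: "nat \<Rightarrow> ('a, 'b) monoid_scheme \<Rightarrow> bool" where
  "p_primary_group p G \<longleftrightarrow> group G \<and> (\<forall>x\<in>carrier G. \<exists>k. group.ord G x = p ^ k)"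

definition extension_subgroups :: "('a, 'b) monoid_scheme \<Rightarrow> 'a set set" where
  "extension_subgroups G =
    {N. subgroup N G \<and>
        (\<forall>f\<in>hom (G\<lparr>carrier := N\<rparr>) G. \<exists>g\<in>hom G G. \<forall>x\<in>N. g x = f x)}"

definition internal_direct_sum ::
  "('a, 'b) monoid_scheme \<Rightarrow> 'a set \<Rightarrow> 'i set \<Rightarrow> ('i \<Rightarrow> 'a set) \<Rightarrow> bool" where
  "internal_direct_sum G H I K \<longleftrightarrow>
    finite I \<and> subgroup H G \<and> (\<forall>i\<in>I. subgroup (K i) G) \<and>
    bij_betw (\<lambda>x. \<Otimes>\<^bsub>G\<^esub>i\<in>I. x i) (\<Pi>\<^sub>E i\<in>I. K i) H"

text \<open>The element \<open>Infty\<close> only makes the minimum of the empty family \<open>Infty\<close>.\<close>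

definition valuated_direct_sum ::
  "nat \<Rightarrow> ('a, 'b) monoid_scheme \<Rightarrow> 'a set \<Rightarrow> 'i set \<Rightarrow> ('i \<Rightarrow> 'a set) \<Rightarrow> bool" where
  "valuated_direct_sum p G H I K \<longleftrightarrow>
    internal_direct_sum G H I K \<and>
    (\<forall>x\<in>(\<Pi>\<^sub>E i\<in>I. K i).
       pheight p G (\<Otimes>\<^bsub>G\<^esub>i\<in>I. x i) = Min (insert Infty ((\<lambda>i. pheight p G (x i)) ` I)))"


section \<open>Heights are well defined\<close>

lemma ppow_subset_carrier:
  assumes "group G" shows "ppow p G \<sigma> \<subseteq> carrier G"
proof (induction \<sigma> rule: less_induct)
  case (less \<sigma>)
  interpret group G by fact
  show ?case
  proof (cases "\<exists>\<rho>. \<sigma> = osuc \<rho>")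
    case True
    then obtain \<rho> where r: "\<sigma> = osuc \<rho>" by blast
    with less[of \<rho>] less_osuc[of \<rho>] show ?thesis by (auto simp: ppow_osuc)
  qed (simp add: ppow_limit)
qed

lemma ppow_subgroup:
  assumes "comm_group G" shows "subgroup (ppow p G \<sigma>) G"
proof (induction \<sigma> rule: less_induct)
  case (less \<sigma>)
  interpret comm_group G by fact
  show ?case
  proof (cases "\<exists>\<rho>. \<sigma> = osuc \<rho>")
    case True
    then obtain \<rho> where r: "\<sigma> = osuc \<rho>" by blast
    have sg: "subgroup (ppow p G \<rho>) G" using less[of \<rho>] less_osuc[of \<rho>] r by simp
    have hom: "group_hom G G (\<lambda>y. y [^]\<^bsub>G\<^esub> p)"
      by unfold_locales (auto simp: hom_def nat_pow_distrib)
    show ?thesis unfolding r ppow_osuc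
      by (rule group_hom.subgroup_img_is_subgroup[OF hom sg])
  next
    case False
    have "ppow p G \<sigma> = \<Inter>(insert (carrier G) (ppow p G ` {..<\<sigma>}))"
      using ppow_limit[OF False, of p G] by auto
    also have "subgroup \<dots> G"
      using less by (intro subgroups_Inter) (auto intro: subgroup_self)
    finally show ?thesis .
  qed
qed

lemma ppow_osuc_subset:
  assumes "comm_group G" shows "ppow p G (osuc \<sigma>) \<subseteq> ppow p G \<sigma>"
proof -
  interpret comm_group G by fact
  interpret S: subgroup "ppow p G \<sigma>" G by (rule ppow_subgroup[OF assms])
  have "y [^]\<^bsub>G\<^esub> k \<in> ppow p G \<sigma>" if "y \<in> ppow p G \<sigma>" for y and k :: nat
    using that by (induction k) auto
  thus ?thesis by (auto simp: ppow_osuc)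
qed

lemma ppow_antimono:
  assumes "comm_group G" "\<rho> \<le> \<sigma>" shows "ppow p G \<sigma> \<subseteq> ppow p G \<rho>"
  using assms(2)
proof (induction \<sigma> rule: less_induct)
  case (less \<sigma>)
  show ?case
  proof (cases "\<rho> = \<sigma>")
    case False
    with less.prems have lt: "\<rho> < \<sigma>" by simp
    show ?thesis
    proof (cases "\<exists>\<tau>. \<sigma> = osuc \<tau>")
      case True
      then obtain \<tau> where t: "\<sigma> = osuc \<tau>" by blast
      have "\<rho> \<le> \<tau>" using lt t by (metis not_le osuc_le_iff)
      with less.IH[of \<tau>] less_osuc[of \<tau>] ppow_osuc_subset[OF assms(1), of p \<tau>] t
      show ?thesis by blast
    qed (use lt ppow_limit in blast)
  qed simp
qed

lemma ppow_stabilises: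
  assumes "comm_group G" shows "\<exists>\<sigma>. ppow p G (osuc \<sigma>) = ppow p G \<sigma>"
proof (rule ccontr)
  assume "\<not> ?thesis"
  hence "\<forall>\<sigma>. \<exists>x. x \<in> ppow p G \<sigma> \<and> x \<notin> ppow p G (osuc \<sigma>)"
    using ppow_osuc_subset[OF assms, of p] by blast
  then obtain f where f: "\<And>\<sigma>. f \<sigma> \<in> ppow p G \<sigma>" "\<And>\<sigma>. f \<sigma> \<notin> ppow p G (osuc \<sigma>)" by metis
  have "f \<sigma> \<noteq> f \<tau>" if "\<sigma> < \<tau>" for \<sigma> \<tau>
    using f ppow_antimono[OF assms, of "osuc \<sigma>" \<tau> p] that by (metis osuc_le_iff subsetD)
  hence "inj f" by (metis injI linorder_neqE)
  thus False using no_inj_ordinal by blast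
qed

lemma pheight_unique:
  assumes "comm_group G" "x \<in> ppow p G \<sigma> - ppow p G (osuc \<sigma>)"
    "x \<in> ppow p G \<tau> - ppow p G (osuc \<tau>)"
  shows "\<sigma> = \<tau>"
proof (rule ccontr)
  assume "\<sigma> \<noteq> \<tau>"
  then consider "osuc \<sigma> \<le> \<tau>" | "osuc \<tau> \<le> \<sigma>" by (metis linorder_neqE osuc_le_iff)
  thus False
    using ppow_antimono[OF assms(1)] assms(2,3) by cases blast+
qed

lemma p_divisible_imp_divisible:
  assumes G: "comm_group G" and p: "prime p" and pG: "p_primary_group p G"
    and D: "subgroup D G" and stab: "(\<lambda>y. y [^]\<^bsub>G\<^esub> p) ` D = D"
  shows "divisible_group (G\<lparr>carrier := D\<rparr>)"
proof -
  interpret comm_group G by fact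
  interpret D: subgroup D G by fact
  have powD: "y [^]\<^bsub>G\<^esub> k \<in> D" if "y \<in> D" for y and k :: nat
    using that by (induction k) auto
  have ppD: "\<exists>y\<in>D. y [^]\<^bsub>G\<^esub> (p ^ k) = x" if "x \<in> D" for x k
    using that
  proof (induction k arbitrary: x)
    case 0 thus ?case by (auto intro!: bexI[of _ x])
  next
    case (Suc k)
    obtain y where y: "y \<in> D" "y [^]\<^bsub>G\<^esub> (p ^ k) = x"
      using Suc.IH[OF Suc.prems] by metis
    have "y \<in> (\<lambda>y. y [^]\<^bsub>G\<^esub> p) ` D" using y(1) by (simp only: stab)
    then obtain z where z: "z \<in> D" "z [^]\<^bsub>G\<^esub> p = y" by (metis imageE)
    have "z [^]\<^bsub>G\<^esub> (p ^ Suc k) = x"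
      using y z by (simp add: nat_pow_pow[symmetric])
    thus ?case using z by blast
  qed
  have copr: "\<exists>y\<in>D. y [^]\<^bsub>G\<^esub> m = x" if x: "x \<in> D" and m: "coprime m p" for x and m :: nat
  proof -
    note xG = D.mem_carrier[OF x]
    obtain k where k: "ord x = p ^ k" using pG xG unfolding p_primary_group_def by metis
    have "coprime m (ord x)" using m k by simp
    then obtain a where a: "[m * a = 1] (mod ord x)"
      using cong_solve_coprime_nat by (metis One_nat_def)
    have "(x [^]\<^bsub>G\<^esub> a) [^]\<^bsub>G\<^esub> m = x [^]\<^bsub>G\<^esub> int (m * a)"
      using xG by (simp only: nat_pow_pow mult.commute int_pow_int)
    also have "\<dots> = x [^]\<^bsub>G\<^esub> (1::int)"
    proof -
      have "[int (m * a) = 1] (mod int (ord x))" using a cong_int_iff[of "m * a" 1] by simp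
      hence "int (ord x) dvd 1 - int (m * a)" by (metis cong_iff_dvd_diff cong_sym)
      thus ?thesis using xG int_pow_eq by blast
    qed
    also have "\<dots> = x" using xG by simp
    finally show ?thesis using powD[OF x] by metis
  qed
  show ?thesis unfolding divisible_group_def
  proof (intro allI impI ballI)
    fix n :: nat and x assume n: "0 < n" and "x \<in> carrier (G\<lparr>carrier := D\<rparr>)"
    hence x: "x \<in> D" by simp
    obtain k m where nm: "n = p ^ k * m" "\<not> p dvd m"
      using n p by (metis multiplicity_decompose' not_prime_unit not_gr_zero)
    have "coprime m p" using nm(2) p by (metis prime_imp_coprime coprime_commute)
    then obtain y where y: "y \<in> D" "y [^]\<^bsub>G\<^esub> m = x" using copr[OF x] by blast
    obtain z where z: "z \<in> D" "z [^]\<^bsub>G\<^esub> (p ^ k) = y" using ppD[OF y(1)] by blast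
    have "z [^]\<^bsub>G\<^esub> n = x" using y z nm by (simp add: nat_pow_pow[symmetric])
    thus "\<exists>y\<in>carrier (G\<lparr>carrier := D\<rparr>). y [^]\<^bsub>G\<lparr>carrier := D\<rparr>\<^esub> n = x"
      using z by (auto simp: nat_pow_consistent[symmetric])
  qed
qed

lemma pheight_exists:
  assumes G: "comm_group G" and p: "prime p" and pG: "p_primary_group p G"
    and x: "x \<in> carrier G" "x \<notin> divisible_part G"
  shows "\<exists>!\<sigma>. x \<in> ppow p G \<sigma> - ppow p G (osuc \<sigma>)"
proof -
  obtain \<delta> where "ppow p G (osuc \<delta>) = ppow p G \<delta>" using ppow_stabilises[OF G] by blast
  hence "divisible_group (G\<lparr>carrier := ppow p G \<delta>\<rparr>)"
    using p_divisible_imp_divisible[OF G p pG ppow_subgroup[OF G]] by (simp add: ppow_osuc)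
  hence "ppow p G \<delta> \<subseteq> divisible_part G"
    unfolding divisible_part_def using ppow_subgroup[OF G, of p \<delta>] by (auto intro!: generate.incl)
  hence ex: "\<exists>\<sigma>. x \<notin> ppow p G \<sigma>" using x by blast
  define \<sigma> where "\<sigma> = (LEAST \<sigma>. x \<notin> ppow p G \<sigma>)"
  have s: "x \<notin> ppow p G \<sigma>" unfolding \<sigma>_def by (rule LeastI_ex[OF ex])
  have l: "x \<in> ppow p G \<tau>" if "\<tau> < \<sigma>" for \<tau>
    using that not_less_Least unfolding \<sigma>_def by blast
  obtain \<rho> where "\<sigma> = osuc \<rho>"
    using s l x ppow_limit[of \<sigma> p G] by blast
  hence "x \<in> ppow p G \<rho> - ppow p G (osuc \<rho>)" using s l less_osuc by blast
  thus ?thesis using pheight_unique[OF G] by blast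
qed

end

theory Submission
  imports Defs
begin

text \<open>
  Endomorphisms never decrease heights. If every homomorphism on \<open>H\<close> extends, then this applies to
  extensions of the projections \<open>H \<rightarrow> K i\<close>, so that a sum has at most the height of each of its
  components (\<open>extension_imp_valuated\<close>), and composing homomorphisms on \<open>K i\<close> with the projection
  shows that \<open>K i\<close> inherits the extension property (\<open>summand_extension\<close>).

  Conversely, let \<open>f\<close> be a homomorphism on \<open>H\<close>. On each \<open>K i\<close> it extends to an endomorphism, and
  the sum is valuated, so \<open>f\<close> does not decrease heights on \<open>H\<close>. In an arbitrary \<open>p\<close>-group this is
  not enough for an extension, since maps between elements of infinite height are hard to extend.
  But here elements of infinite height, that is, elements of all the finite levels \<open>p\<^sup>k G\<close>, occur only
  for a trivial reason. Suppose that a cyclic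
  \<open>K i\<close> of order \<open>p\<^sup>m\<^sup>+\<^sup>1\<close> contains a nontrivial element of infinite height; then its socle has infinite
  height. As a generator of \<open>K i\<close> can be mapped to every element of order dividing \<open>p\<^sup>m\<^sup>+\<^sup>1\<close>, the whole
  socle of \<open>p\<^sup>m G\<close> has infinite height, and this forces \<open>p\<^sup>m G\<close> to be divisible
  (\<open>powers_stabilise_if_infinite_height\<close>). As \<open>H\<close> is finite, some \<open>m\<close> therefore satisfies
  \<open>H \<inter> p\<^sup>m G = 0\<close> or \<open>p\<^sup>m\<^sup>+\<^sup>1 G = p\<^sup>m G\<close>.

  For such an \<open>m\<close> only the finite filtration \<open>G \<supseteq> p G \<supseteq> \<dots> \<supseteq> p\<^sup>m G\<close> matters: every homomorphism on \<open>H\<close>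
  that respects it extends to \<open>G\<close> (\<open>filtration_preserving_hom_extends\<close>). This is proved by adjoining
  one element at a time with Zorn's lemma. Since only the levels up to \<open>m\<close> are compared, each coset
  contains an element of largest level, even when the domain already reached is infinite, and such an
  element can be given a \<open>p\<close>-th root of the prescribed image on its own level.
\<close>

section \<open>Heights\<close>

locale primary_comm_group = comm_group G for G :: "('a, 'b) monoid_scheme" (structure) +
  fixes p :: nat
  assumes prime_p: "prime p" and primary: "p_primary_group p G"
begin

lemma hom_ppow:
  assumes g: "g \<in> hom G G" and x: "x \<in> ppow p G \<sigma>"
  shows "g x \<in> ppow p G \<sigma>"
  using x
proof (induction \<sigma> arbitrary: x rule: less_induct)
  case (less \<sigma>)
  have car: "x \<in> carrier G"
    using less.prems ppow_subset_carrier[OF is_group] by blast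
  show ?case
  proof (cases "\<exists>\<rho>. \<sigma> = osuc \<rho>")
    case True
    then obtain \<rho> where r: "\<sigma> = osuc \<rho>" by blast
    with less.prems obtain y where y: "y \<in> ppow p G \<rho>" "x = y [^] p"
      by (auto simp: ppow_osuc)
    have "y \<in> carrier G" using y(1) ppow_subset_carrier[OF is_group] by blast
    hence "g x = g y [^] p" using y(2) hom_nat_pow[OF g] is_group by simp
    thus ?thesis using less.IH[OF _ y(1)] less_osuc r by (auto simp: ppow_osuc)
  next
    case False
    thus ?thesis using less car hom_in_carrier[OF g] by (simp add: ppow_limit)
  qed
qed

text \<open>
  A \<open>p\<close>-divisible subgroup of a \<open>p\<close>-group is divisible, and the transfinite powers stabilise at one,
  so an element has height \<open>Infty\<close> exactly if it lies in all of them.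
\<close>

lemma divisible_part_eq: "divisible_part G = (\<Inter>\<sigma>. ppow p G \<sigma>)"
proof
  have D: "D \<subseteq> ppow p G \<sigma>"
    if D: "subgroup D G" "divisible_group (G\<lparr>carrier := D\<rparr>)" for D \<sigma>
  proof (induction \<sigma> rule: less_induct)
    case (less \<sigma>)
    show ?case
    proof (cases "\<exists>\<rho>. \<sigma> = osuc \<rho>")
      case True
      then obtain \<rho> where r: "\<sigma> = osuc \<rho>" by blast
      have "\<exists>y\<in>D. y [^] p = x" if "x \<in> D" for x
        using D(2) that prime_gt_0_nat[OF prime_p]
        unfolding divisible_group_def by (simp add: nat_pow_consistent[symmetric])
      with less[of \<rho>] show ?thesis using less_osuc by (force simp: r ppow_osuc)
    next
      case False
      thus ?thesis using less subgroup.subset[OF D(1)] by (auto simp: ppow_limit)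
    qed
  qed
  show "divisible_part G \<subseteq> (\<Inter>\<sigma>. ppow p G \<sigma>)"
    unfolding divisible_part_def
    by (intro INT_greatest generate_subgroup_incl ppow_subgroup comm_group_axioms) (use D in auto)
  show "(\<Inter>\<sigma>. ppow p G \<sigma>) \<subseteq> divisible_part G"
  proof
    fix x assume x: "x \<in> (\<Inter>\<sigma>. ppow p G \<sigma>)"
    hence "x \<in> carrier G" using ppow_subset_carrier[OF is_group] by blast
    thus "x \<in> divisible_part G"
      using x pheight_exists[OF comm_group_axioms prime_p primary, of x] by auto
  qed
qed

text \<open>
  Heights are only ever used through this equivalence. It turns their inequalities into membership in
  subgroups that endomorphisms preserve, with no case distinction at \<open>Infty\<close>.
\<close>

lemma Height_le_pheight_iff:
  assumes "x \<in> carrier G"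
  shows "Height \<sigma> \<le> pheight p G x \<longleftrightarrow> x \<in> ppow p G \<sigma>"
proof (cases "x \<in> divisible_part G")
  case True
  thus ?thesis by (auto simp: pheight_def divisible_part_eq)
next
  case False
  note ex = pheight_exists[OF comm_group_axioms prime_p primary assms False]
  define \<tau> where "\<tau> = (THE \<sigma>. x \<in> ppow p G \<sigma> - ppow p G (osuc \<sigma>))"
  have t: "x \<in> ppow p G \<tau>" "x \<notin> ppow p G (osuc \<tau>)"
    using theI'[OF ex] unfolding \<tau>_def by auto
  have "\<sigma> \<le> \<tau> \<longleftrightarrow> x \<in> ppow p G \<sigma>"
    using t ppow_antimono[OF comm_group_axioms, of _ _ p]
    by (meson in_mono linorder_not_le osuc_le_iff)
  thus ?thesis using False by (simp add: pheight_def \<tau>_def)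
qed

text \<open>
  A height is determined by the ordinals below it because there is no largest ordinal: at \<open>Infty\<close>
  versus \<open>Height \<sigma>\<close> the ordinal \<open>osuc \<sigma>\<close> makes the difference.
\<close>

lemma pheight_eq_Min_iff:
  assumes "finite I" "y \<in> carrier G" "\<And>i. i \<in> I \<Longrightarrow> x i \<in> carrier G"
  shows "pheight p G y = Min (insert Infty ((\<lambda>i. pheight p G (x i)) ` I)) \<longleftrightarrow>
    (\<forall>\<sigma>. y \<in> ppow p G \<sigma> \<longleftrightarrow> (\<forall>i\<in>I. x i \<in> ppow p G \<sigma>))" (is "_ = ?m \<longleftrightarrow> _")
proof -
  have eqI: "a = b \<longleftrightarrow> (\<forall>\<sigma>. Height \<sigma> \<le> a \<longleftrightarrow> Height \<sigma> \<le> b)" for a b :: "'a height"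
  proof
    assume ab: "\<forall>\<sigma>. Height \<sigma> \<le> a \<longleftrightarrow> Height \<sigma> \<le> b"
    show "a = b"
    proof (cases a; cases b)
      fix \<sigma> \<tau> assume "a = Height \<sigma>" "b = Height \<tau>"
      with ab show ?thesis by (auto intro: antisym)
    next
      fix \<sigma> assume "a = Height \<sigma>" "b = Infty"
      with ab[rule_format, of "osuc \<sigma>"] show ?thesis by (simp add: osuc_le_iff)
    next
      fix \<sigma> assume "a = Infty" "b = Height \<sigma>"
      with ab[rule_format, of "osuc \<sigma>"] show ?thesis by (simp add: osuc_le_iff)
    qed simp
  qed simp
  have "Height \<sigma> \<le> ?m \<longleftrightarrow> (\<forall>i\<in>I. x i \<in> ppow p G \<sigma>)" for \<sigma>
    using assms by (simp add: Min_ge_iff Height_le_pheight_iff)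
  thus ?thesis using assms by (simp add: eqI[of "pheight p G y"] Height_le_pheight_iff)
qed

text \<open>
  The finite levels \<open>p\<^sup>k G\<close> of the transfinite sequence, described by \<open>p\<^sup>k\<close>-th powers so that a
  \<open>p\<^sup>k\<close>-th root can be taken in a single step.
\<close>

definition powers :: "nat \<Rightarrow> 'a set" where
  "powers k = (\<lambda>y. y [^] (p ^ k)) ` carrier G"

lemma powers_0: "powers 0 = carrier G"
  by (force simp: powers_def)

lemma powers_Suc: "powers (Suc k) = (\<lambda>y. y [^] p) ` powers k"
  by (auto simp: powers_def image_image nat_pow_pow mult.commute intro!: image_cong)

lemma powers_eq_ppow: "\<exists>\<sigma>. powers k = ppow p G \<sigma>"
proof (induction k)
  case 0
  let ?z = "LEAST \<sigma> :: 'a ordinal. True"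
  have z: "?z \<le> \<rho>" for \<rho> by (simp add: Least_le)
  hence "?z \<noteq> osuc \<rho>" for \<rho>
    using less_osuc[of \<rho>] by (metis leD)
  moreover have "{..<?z} = {}"
    using z by (auto simp: leD)
  ultimately have "ppow p G ?z = carrier G" by (simp add: ppow_limit)
  thus ?case by (metis powers_0)
next
  case (Suc k)
  thus ?case by (metis powers_Suc ppow_osuc)
qed

lemma powers_subgroup: "subgroup (powers k) G"
  using powers_eq_ppow[of k] ppow_subgroup[OF comm_group_axioms] by metis

lemma hom_powers: "g \<in> hom G G \<Longrightarrow> x \<in> powers k \<Longrightarrow> g x \<in> powers k"
  using powers_eq_ppow[of k] hom_ppow by metis

lemma powers_antimono: "j \<le> k \<Longrightarrow> powers k \<subseteq> powers j"
proof (induction k rule: dec_induct)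
  case (step k)
  have "powers (Suc k) \<subseteq> powers k"
    using powers_eq_ppow[of k] by (metis powers_Suc ppow_osuc ppow_osuc_subset comm_group_axioms)
  with step show ?case by blast
qed simp

end

section \<open>Extending homomorphisms\<close>

context primary_comm_group
begin

text \<open>
  A homomorphism from a subgroup of \<open>G\<close> to \<open>G\<close> is encoded by its graph, a subgroup of \<open>G \<times> G\<close> with
  trivial fibre over the identity. The union of a chain of partial homomorphisms is then simply the
  union of sets.
\<close>

definition partial_endo :: "('a \<times> 'a) set \<Rightarrow> bool" where
  "partial_endo R \<longleftrightarrow> subgroup R (G \<times>\<times> G) \<and> (\<forall>y. (\<one>, y) \<in> R \<longrightarrow> y = \<one>)"

lemma partial_endoD:
  fixes i :: int
  assumes "partial_endo R"
  shows "(x, y) \<in> R \<Longrightarrow> x \<in> carrier G" "(x, y) \<in> R \<Longrightarrow> y \<in> carrier G"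
    "(\<one>, y) \<in> R \<Longrightarrow> y = \<one>" "(\<one>, \<one>) \<in> R"
    "(x, y) \<in> R \<Longrightarrow> (x', y') \<in> R \<Longrightarrow> (x \<otimes> x', y \<otimes> y') \<in> R"
    "(x, y) \<in> R \<Longrightarrow> (inv x, inv y) \<in> R"
    "(x, y) \<in> R \<Longrightarrow> (x [^] i, y [^] i) \<in> R"
proof -
  interpret GG: group "G \<times>\<times> G" by (intro DirProd_group is_group)
  interpret R: subgroup R "G \<times>\<times> G" using assms by (simp add: partial_endo_def)
  show *: "(x, y) \<in> R \<Longrightarrow> x \<in> carrier G" "(x, y) \<in> R \<Longrightarrow> y \<in> carrier G" for x y
    using R.subset by auto
  show "(\<one>, y) \<in> R \<Longrightarrow> y = \<one>" using assms by (simp add: partial_endo_def)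
  show "(\<one>, \<one>) \<in> R" using R.one_closed by simp
  show "(x, y) \<in> R \<Longrightarrow> (x', y') \<in> R \<Longrightarrow> (x \<otimes> x', y \<otimes> y') \<in> R"
    using R.m_closed[of "(x, y)" "(x', y')"] by simp
  show "(inv x, inv y) \<in> R" if "(x, y) \<in> R"
    using R.m_inv_closed[OF that] *[OF that] by (simp add: is_group)
  show "(x [^] i, y [^] i) \<in> R" if xy: "(x, y) \<in> R"
  proof -
    have "fst \<in> hom (G \<times>\<times> G) G" "snd \<in> hom (G \<times>\<times> G) G"
      by (auto simp: hom_def)
    hence "(x, y) [^]\<^bsub>G \<times>\<times> G\<^esub> i = (x [^] i, y [^] i)"
      using hom_int_pow[of fst "G \<times>\<times> G" G "(x, y)" i] hom_int_pow[of snd "G \<times>\<times> G" G "(x, y)" i]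
        GG.is_group is_group *[OF xy] by (simp add: prod_eq_iff)
    thus ?thesis using GG.subgroup_int_pow_closed[OF R.subgroup_axioms xy] by metis
  qed
qed

lemma partial_endo_right_unique:
  assumes R: "partial_endo R" and xy: "(x, y) \<in> R" "(x, z) \<in> R"
  shows "y = z"
proof -
  have "(x \<otimes> inv x, y \<otimes> inv z) \<in> R"
    using partial_endoD[OF R] xy by blast
  hence "y \<otimes> inv z = \<one>"
    using partial_endoD[OF R] xy by simp
  thus ?thesis using partial_endoD(2)[OF R] xy
    by (metis inv_closed inv_equality inv_inv)
qed

lemma partial_endoI:
  assumes "R \<subseteq> carrier G \<times> carrier G" "(\<one>, \<one>) \<in> R"
    and "\<And>x y x' y'. (x, y) \<in> R \<Longrightarrow> (x', y') \<in> R \<Longrightarrow> (x \<otimes> x', y \<otimes> y') \<in> R"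
    and "\<And>x y. (x, y) \<in> R \<Longrightarrow> (inv x, inv y) \<in> R"
    and "\<And>y. (\<one>, y) \<in> R \<Longrightarrow> y = \<one>"
  shows "partial_endo R"
proof -
  interpret GG: group "G \<times>\<times> G" by (intro DirProd_group is_group)
  have "subgroup R (G \<times>\<times> G)"
  proof (rule GG.subgroupI)
    fix a assume "a \<in> R"
    with assms(1,4) show "inv\<^bsub>G \<times>\<times> G\<^esub> a \<in> R" by (cases a) (auto simp: is_group)
  next
    fix a b assume "a \<in> R" "b \<in> R"
    with assms(3) show "a \<otimes>\<^bsub>G \<times>\<times> G\<^esub> b \<in> R" by (cases a; cases b) auto
  qed (use assms in auto)
  with assms(5) show ?thesis by (simp add: partial_endo_def)
qed

text \<open>
  Only the levels up to \<open>m\<close> are compared. Elements of \<open>p\<^sup>m G\<close> all count as being on level \<open>m\<close>, so that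
  levels are bounded and maximal ones always exist.
\<close>

definition filtered_endo :: "nat \<Rightarrow> ('a \<times> 'a) set \<Rightarrow> bool" where
  "filtered_endo m R \<longleftrightarrow> partial_endo R \<and>
    (\<forall>(x, y)\<in>R. \<forall>k\<le>m. x \<in> powers k \<longrightarrow> y \<in> powers k)"

text \<open>
  Let \<open>u\<close> have the largest level \<open>k \<le> m\<close> in the coset of \<open>x\<close> modulo the domain. Then \<open>u\<^sup>p\<close> is on level
  \<open>k + 1\<close>, hence so is its image \<open>d\<close>, and \<open>d\<close> has a \<open>p\<close>-th root \<open>w\<close> on level \<open>k\<close>; the extension sends \<open>u\<close>
  to \<open>w\<close>. It respects the filtration because, by maximality of \<open>k\<close>, a product of an element \<open>a\<close> of the domain
  and a power of \<open>u\<close> outside it can be on level \<open>l \<le> m\<close> only if \<open>l \<le> k\<close>, and then \<open>u\<close> and \<open>a\<close> are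
  separately on level \<open>l\<close>. The hypothesis on \<open>powers m\<close> handles
  \<open>k = m\<close>, where level \<open>k + 1\<close> is no longer controlled: either this case cannot occur or the two
  levels agree.
\<close>

lemma filtered_endo_extend:
  assumes R: "filtered_endo m R" and m: "powers m \<subseteq> Domain R \<or> powers (Suc m) = powers m"
    and x: "x \<in> carrier G" "x \<notin> Domain R" "x [^] p \<in> Domain R"
  shows "\<exists>R'. filtered_endo m R' \<and> R \<subset> R'"
proof -
  have pe: "partial_endo R" using R by (simp add: filtered_endo_def)
  note D = partial_endoD[OF pe]
  have filt: "b \<in> powers l" if "(a, b) \<in> R" "l \<le> m" "a \<in> powers l" for a b l
    using R that by (auto simp: filtered_endo_def)
  define S where "S = {k. k \<le> m \<and> (\<exists>a\<in>Domain R. x \<otimes> a \<in> powers k)}"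
  have "finite S" by (simp add: S_def)
  have "0 \<in> S" using D(4) x(1) by (auto simp: S_def powers_0 intro!: bexI[of _ \<one>])
  define k where "k = Max S"
  have "k \<in> S" unfolding k_def using \<open>finite S\<close> \<open>0 \<in> S\<close> by (intro Max_in) auto
  then obtain a0 b0 where k: "k \<le> m" "(a0, b0) \<in> R" "x \<otimes> a0 \<in> powers k"
    by (auto simp: S_def)
  define u where "u = x \<otimes> a0"
  have u: "u \<in> carrier G" "u \<in> powers k" using k D(1) x(1) by (auto simp: u_def)
  have udom: "u \<notin> Domain R"
  proof
    assume "u \<in> Domain R"
    then obtain v where "(u, v) \<in> R" by blast
    hence "(u \<otimes> inv a0, v \<otimes> inv b0) \<in> R" using D k by blast
    moreover have "u \<otimes> inv a0 = x" using D(1)[OF k(2)] x(1) by (simp add: u_def m_assoc)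
    ultimately show False using x(2) by auto
  qed
  have kmax: "l \<le> k" if "l \<le> m" "(a, b) \<in> R" "u \<otimes> a \<in> powers l" for l a b
  proof -
    have "(a0 \<otimes> a, b0 \<otimes> b) \<in> R" using D k that by blast
    moreover have "x \<otimes> (a0 \<otimes> a) \<in> powers l"
      using that D(1)[OF that(2)] D(1)[OF k(2)] x(1) by (simp add: u_def m_assoc)
    ultimately have "l \<in> S" using that(1) by (auto simp: S_def)
    thus ?thesis using \<open>finite S\<close> by (simp add: k_def)
  qed
  obtain c where "(x [^] p, c) \<in> R" using x(3) by blast
  hence up: "(u [^] p, c \<otimes> b0 [^] int p) \<in> R"
    using D(5)[OF _ D(7)[OF k(2), of "int p"]] x(1) D(1)[OF k(2)]
    by (auto simp: u_def int_pow_int nat_pow_distrib)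
  define d where "d = c \<otimes> b0 [^] int p"
  have d: "(u [^] p, d) \<in> R" using up by (simp add: d_def)
  have upp: "u [^] p \<in> powers (Suc k)" using u by (auto simp: powers_Suc)
  have "d \<in> powers (Suc k)"
  proof (cases "k < m")
    case True
    thus ?thesis using filt[OF d _ upp] by simp
  next
    case False
    with k have "k = m" by simp
    with m u udom have eq: "powers (Suc k) = powers k" by blast
    thus ?thesis using filt[OF d k(1)] upp by simp
  qed
  then obtain w where w: "w \<in> powers k" "d = w [^] p" by (auto simp: powers_Suc)
  have wc: "w \<in> carrier G" using w(1) subgroup.subset[OF powers_subgroup] by blast
  define R' where "R' = {(u [^] i \<otimes> a, w [^] i \<otimes> b) |(i::int) a b. (a, b) \<in> R}"
  have memI: "(u [^] i \<otimes> a, w [^] i \<otimes> b) \<in> R'" if "(a, b) \<in> R" for i :: int and a b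
    using that by (auto simp: R'_def)
  \<comment> \<open>Modulo the old domain, \<open>u\<close> has order \<open>p\<close>: a power of \<open>u\<close> either lies in the domain already, or has
      an exponent that is invertible modulo \<open>p\<close> and can then be normalised to \<open>1\<close>.\<close>
  have pcase: "(u [^] i \<otimes> a, w [^] i \<otimes> b) \<in> R" if ab: "(a, b) \<in> R" and pi: "int p dvd i" for i a b
  proof -
    obtain j where j: "i = int p * j" using pi by blast
    have "(u [^] i, w [^] i) \<in> R"
      using D(7)[OF d, of j] u(1) wc w(2) by (simp add: j int_pow_pow flip: int_pow_int)
    thus ?thesis using D(5) ab by blast
  qed
  have npcase: "\<exists>(s::int) a' b'. (a', b') \<in> R \<and> (u [^] i \<otimes> a) [^] s = u \<otimes> a'"
    if ab: "(a, b) \<in> R" and pi: "\<not> int p dvd i" for i a b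
  proof -
    have "coprime (int p) i" using pi prime_p by (simp add: prime_imp_coprime)
    then obtain s t where st: "i * s + int p * t = 1"
      by (metis bezout_int coprime_iff_gcd_eq_1 mult.commute add.commute)
    hence eq: "i * s = 1 - int p * t" by simp
    have ac: "a \<in> carrier G" using D(1) ab .
    have "(u [^] i \<otimes> a) [^] s = u [^] (1 - int p * t) \<otimes> a [^] s"
      using u(1) ac eq by (simp add: int_pow_distrib int_pow_pow)
    also have "\<dots> = u \<otimes> ((u [^] p) [^] (- t) \<otimes> a [^] s)"
      using u(1) ac by (simp add: int_pow_diff int_pow_neg int_pow_pow m_assoc flip: int_pow_int)
    finally show ?thesis
      using D(5)[OF D(7)[OF d, of "- t"] D(7)[OF ab, of s]] by blast
  qed
  have pe': "partial_endo R'"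
  proof (rule partial_endoI)
    show "R' \<subseteq> carrier G \<times> carrier G" using D(1,2) u(1) wc by (auto simp: R'_def)
    show "(\<one>, \<one>) \<in> R'" using memI[OF D(4), of 0] by simp
  next
    fix x y x' y' assume "(x, y) \<in> R'" "(x', y') \<in> R'"
    then obtain i :: int and a b and i' :: int and a' b' where *: "x = u [^] i \<otimes> a" "y = w [^] i \<otimes> b" "(a, b) \<in> R"
      "x' = u [^] i' \<otimes> a'" "y' = w [^] i' \<otimes> b'" "(a', b') \<in> R"
      by (auto simp: R'_def)
    have "x \<otimes> x' = u [^] (i + i') \<otimes> (a \<otimes> a')" "y \<otimes> y' = w [^] (i + i') \<otimes> (b \<otimes> b')"
      using * u(1) wc D(1,2) by (simp_all add: int_pow_mult m_ac)
    thus "(x \<otimes> x', y \<otimes> y') \<in> R'" using memI[OF D(5)[OF *(3) *(6)], of "i + i'"] by simp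
  next
    fix x y assume "(x, y) \<in> R'"
    then obtain i :: int and a b where *: "x = u [^] i \<otimes> a" "y = w [^] i \<otimes> b" "(a, b) \<in> R"
      by (auto simp: R'_def)
    have "inv x = u [^] (- i) \<otimes> inv a" "inv y = w [^] (- i) \<otimes> inv b"
      using * u(1) wc D(1,2) by (simp_all add: inv_mult int_pow_neg)
    thus "(inv x, inv y) \<in> R'" using memI[OF D(6)[OF *(3)], of "- i"] by simp
  next
    fix y assume "(\<one>, y) \<in> R'"
    then obtain i :: int and a b where *: "\<one> = u [^] i \<otimes> a" "y = w [^] i \<otimes> b" "(a, b) \<in> R"
      by (auto simp: R'_def)
    show "y = \<one>"
    proof (cases "int p dvd i")
      case True
      show ?thesis using pcase[OF *(3) True] D(3) *(1,2) by metis
    next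
      case False
      from npcase[OF *(3) False] obtain s :: int and a' b'
        where a': "(a', b') \<in> R" "(u [^] i \<otimes> a) [^] s = u \<otimes> a'" by blast
      hence "u = inv a'" using *(1) u(1) D(1)[OF a'(1)]
        by (metis int_pow_one inv_equality)
      with D(6)[OF a'(1)] udom show ?thesis by blast
    qed
  qed
  have filt': "z \<in> powers l" if yz: "(y, z) \<in> R'" and l: "l \<le> m" "y \<in> powers l" for y z l
  proof -
    interpret L: subgroup "powers l" G by (rule powers_subgroup)
    obtain i :: int and a b where *: "y = u [^] i \<otimes> a" "z = w [^] i \<otimes> b" "(a, b) \<in> R"
      using yz by (auto simp: R'_def)
    show ?thesis
    proof (cases "int p dvd i")
      case True
      show ?thesis using filt[OF pcase[OF *(3) True] l(1)] l(2) *(1,2) by simp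
    next
      case False
      from npcase[OF *(3) False] obtain s :: int and a' b'
        where a': "(a', b') \<in> R" "(u [^] i \<otimes> a) [^] s = u \<otimes> a'" by blast
      have "y [^] s \<in> powers l" using l(2) by (rule subgroup_int_pow_closed[OF powers_subgroup])
      hence "l \<le> k" using kmax[OF l(1) a'(1)] a'(2) *(1) by simp
      hence uw: "u \<in> powers l" "w \<in> powers l" using powers_antimono u(2) w(1) by blast+
      have "inv (u [^] i) \<otimes> y \<in> powers l"
        using uw l(2) subgroup_int_pow_closed[OF powers_subgroup] by blast
      moreover have "inv (u [^] i) \<otimes> y = a"
        using u(1) D(1)[OF *(3)] by (simp add: *(1) m_assoc[symmetric])
      ultimately have "b \<in> powers l" using filt[OF *(3) l(1)] by simp
      thus ?thesis using uw subgroup_int_pow_closed[OF powers_subgroup] *(2) by blast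
    qed
  qed
  have "R \<subseteq> R'"
  proof
    fix z assume "z \<in> R"
    thus "z \<in> R'" using memI[of "fst z" "snd z" 0] D(1,2)[of "fst z" "snd z"] by simp
  qed
  moreover have "(u, w) \<in> R'" using memI[OF D(4), of 1] u(1) wc by simp
  ultimately show ?thesis
    using pe' filt' udom by (intro exI[of _ R']) (auto simp: filtered_endo_def)
qed

text \<open>
  If a maximal extension missed some \<open>x\<close>, then the last of the powers \<open>x, x\<^sup>p, (x\<^sup>p)\<^sup>p, \<dots>\<close> outside its
  domain would have its \<open>p\<close>-th power inside, and could be adjoined.
\<close>

lemma filtered_endo_total:
  assumes R: "filtered_endo m R" and m: "powers m \<subseteq> Domain R \<or> powers (Suc m) = powers m"
  shows "\<exists>g\<in>hom G G. \<forall>(x, y)\<in>R. g x = y"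
proof -
  define F where "F = {M. filtered_endo m M \<and> R \<subseteq> M}"
  have "\<exists>M\<in>F. \<forall>X\<in>F. M \<subseteq> X \<longrightarrow> X = M"
  proof (rule subset_Zorn_nonempty)
    show "F \<noteq> {}" using R by (auto simp: F_def)
  next
    fix \<C> assume ne: "\<C> \<noteq> {}" and ch: "subset.chain F \<C>"
    have CF: "filtered_endo m M" "partial_endo M" "R \<subseteq> M" if "M \<in> \<C>" for M
      using ch that unfolding F_def subset_chain_def filtered_endo_def by blast+
    have lin: "\<exists>M\<in>\<C>. a \<in> M \<and> b \<in> M" if "a \<in> \<Union>\<C>" "b \<in> \<Union>\<C>" for a b
      using ch that unfolding subset_chain_def by blast
    have "partial_endo (\<Union>\<C>)"
    proof (rule partial_endoI)
      show "\<Union>\<C> \<subseteq> carrier G \<times> carrier G" using partial_endoD(1,2)[OF CF(2)] by auto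
      show "(\<one>, \<one>) \<in> \<Union>\<C>" using partial_endoD(4)[OF CF(2)] ne by auto
    next
      fix x y x' y' assume "(x, y) \<in> \<Union>\<C>" "(x', y') \<in> \<Union>\<C>"
      with lin obtain M where "M \<in> \<C>" "(x, y) \<in> M" "(x', y') \<in> M" by blast
      thus "(x \<otimes> x', y \<otimes> y') \<in> \<Union>\<C>" using partial_endoD(5)[OF CF(2)] by blast
    qed (use partial_endoD(3,6)[OF CF(2)] in blast)+
    thus "\<Union>\<C> \<in> F" using CF ne by (fastforce simp: F_def filtered_endo_def)
  qed
  then obtain M where M: "filtered_endo m M" "R \<subseteq> M"
    and max: "\<And>X. filtered_endo m X \<Longrightarrow> M \<subseteq> X \<Longrightarrow> X = M"
    by (auto simp: F_def)
  have pe: "partial_endo M" using M by (simp add: filtered_endo_def)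
  note D = partial_endoD[OF pe]
  have total: "x \<in> Domain M" if x: "x \<in> carrier G" for x
  proof (rule ccontr)
    assume nx: "x \<notin> Domain M"
    obtain r where r: "ord x = p ^ r" using primary x by (auto simp: p_primary_group_def)
    define j where "j = (LEAST j. x [^] (p ^ j) \<in> Domain M)"
    have "x [^] (p ^ r) \<in> Domain M" using pow_ord_eq_1[OF x] D(4) r by auto
    hence j: "x [^] (p ^ j) \<in> Domain M" unfolding j_def by (rule LeastI)
    with nx x have "j \<noteq> 0" by (intro notI) simp
    then obtain i where i: "j = Suc i" using not0_implies_Suc by blast
    have "x [^] (p ^ i) \<notin> Domain M"
      using not_less_Least[of i "\<lambda>j. x [^] (p ^ j) \<in> Domain M"] i by (simp add: j_def)
    moreover have "(x [^] (p ^ i)) [^] p \<in> Domain M"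
      using j x by (simp add: i nat_pow_pow mult.commute)
    ultimately show False
      using filtered_endo_extend[OF M(1), of "x [^] (p ^ i)"] m M(2) max x by blast
  qed
  define g where "g x = (SOME y. (x, y) \<in> M)" for x
  have gM: "(x, g x) \<in> M" if "x \<in> carrier G" for x
    using total[OF that] unfolding g_def by (auto intro: someI)
  have geq: "g x = y" if "(x, y) \<in> M" for x y
    using partial_endo_right_unique[OF pe gM that] D(1) that by blast
  have "g \<in> hom G G"
  proof (rule homI)
    show "g x \<in> carrier G" if "x \<in> carrier G" for x using D(2)[OF gM[OF that]] .
    show "g (x \<otimes> y) = g x \<otimes> g y" if "x \<in> carrier G" "y \<in> carrier G" for x y
      using geq[OF D(5)[OF gM gM]] that by simp
  qed
  moreover have "\<forall>(x, y)\<in>R. g x = y" using geq M(2) by auto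
  ultimately show ?thesis by blast
qed

text \<open>
  If \<open>H\<close> meets \<open>p\<^sup>m G\<close> trivially, then \<open>f\<close> is first extended by the trivial map on \<open>p\<^sup>m G\<close>, which puts
  \<open>p\<^sup>m G\<close> into the domain. If \<open>p\<^sup>m G\<close> is \<open>p\<close>-divisible, the construction starts at \<open>H\<close> itself, and roots
  of elements of \<open>p\<^sup>m G\<close> can be taken inside \<open>p\<^sup>m G\<close>.
\<close>

lemma filtration_preserving_hom_extends:
  assumes H: "subgroup H G" and f: "f \<in> hom (G\<lparr>carrier := H\<rparr>) G"
    and filt: "\<And>k x. k \<le> m \<Longrightarrow> x \<in> H \<Longrightarrow> x \<in> powers k \<Longrightarrow> f x \<in> powers k"
    and m: "H \<inter> powers m = {\<one>} \<or> powers (Suc m) = powers m"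
  shows "\<exists>g\<in>hom G G. \<forall>x\<in>H. g x = f x"
proof -
  interpret H: subgroup H G by fact
  interpret HG: group_hom "G\<lparr>carrier := H\<rparr>" G f
    using f H.subgroup_is_group[OF is_group] is_group
    by (simp add: group_hom_def group_hom_axioms_def)
  have fH: "f x \<in> carrier G" if "x \<in> H" for x using HG.hom_closed that by simp
  have fm: "f (x \<otimes> y) = f x \<otimes> f y" if "x \<in> H" "y \<in> H" for x y
    using HG.hom_mult that by simp
  have f1: "f \<one> = \<one>" using HG.hom_one by simp
  have fi: "f (inv x) = inv (f x)" if "x \<in> H" for x
    using HG.hom_inv that by (simp add: m_inv_consistent[OF H])
  \<comment> \<open>The subgroup on which the initial extension is trivial.\<close>
  define D where "D = (if H \<inter> powers m = {\<one>} then powers m else {\<one>})"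
  have D: "subgroup D G" "H \<inter> D = {\<one>}" "D \<subseteq> powers m"
    using powers_subgroup[of m] triv_subgroup subgroup.one_closed[OF powers_subgroup]
    by (auto simp: D_def)
  interpret D: subgroup D G by fact
  have Dm: "D \<subseteq> powers k" if "k \<le> m" for k using D(3) powers_antimono that by blast
  define R where "R = {(h \<otimes> d, f h) |h d. h \<in> H \<and> d \<in> D}"
  have memI: "(h \<otimes> d, f h) \<in> R" if "h \<in> H" "d \<in> D" for h d using that by (auto simp: R_def)
  have "partial_endo R"
  proof (rule partial_endoI)
    show "R \<subseteq> carrier G \<times> carrier G" using fH by (auto simp: R_def)
    show "(\<one>, \<one>) \<in> R" using memI[OF H.one_closed D.one_closed] f1 by simp
  next
    fix x y x' y' assume "(x, y) \<in> R" "(x', y') \<in> R"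
    then obtain h d h' d' where *: "x = h \<otimes> d" "y = f h" "x' = h' \<otimes> d'" "y' = f h'"
      "h \<in> H" "d \<in> D" "h' \<in> H" "d' \<in> D" by (auto simp: R_def)
    hence "x \<otimes> x' = (h \<otimes> h') \<otimes> (d \<otimes> d')" "y \<otimes> y' = f (h \<otimes> h')"
      using fm by (auto simp: m_ac)
    thus "(x \<otimes> x', y \<otimes> y') \<in> R" using memI[of "h \<otimes> h'" "d \<otimes> d'"] * by simp
  next
    fix x y assume "(x, y) \<in> R"
    then obtain h d where *: "x = h \<otimes> d" "y = f h" "h \<in> H" "d \<in> D" by (auto simp: R_def)
    hence "inv x = inv h \<otimes> inv d" "inv y = f (inv h)"
      using fi by (auto simp: inv_mult)
    thus "(inv x, inv y) \<in> R" using memI[of "inv h" "inv d"] * by simp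
  next
    fix y assume "(\<one>, y) \<in> R"
    then obtain h d where *: "\<one> = h \<otimes> d" "y = f h" "h \<in> H" "d \<in> D" by (auto simp: R_def)
    hence "h = inv d" by (metis inv_equality H.mem_carrier D.mem_carrier)
    hence "h \<in> H \<inter> D" using *(3,4) by blast
    hence "h = \<one>" using D(2) by blast
    thus "y = \<one>" using *(2) f1 by simp
  qed
  moreover have "y \<in> powers k" if "(x, y) \<in> R" and k: "k \<le> m" "x \<in> powers k" for x y k
  proof -
    interpret K: subgroup "powers k" G by (rule powers_subgroup)
    from that obtain h d where *: "x = h \<otimes> d" "y = f h" "h \<in> H" "d \<in> D" by (auto simp: R_def)
    hence "h = x \<otimes> inv d" by (simp add: m_assoc)
    moreover have "d \<in> powers k" using Dm[OF k(1)] *(4) by blast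
    ultimately have "h \<in> powers k" using k(2) by simp
    thus ?thesis using filt k(1) *(2,3) by blast
  qed
  ultimately have "filtered_endo m R" unfolding filtered_endo_def by blast
  moreover have "powers m \<subseteq> Domain R \<or> powers (Suc m) = powers m"
  proof (cases "H \<inter> powers m = {\<one>}")
    case True
    hence "D = powers m" by (simp add: D_def)
    moreover have "d \<in> Domain R" if "d \<in> D" for d
      using memI[OF H.one_closed that] D.mem_carrier[OF that] by (simp add: DomainI)
    ultimately show ?thesis by blast
  qed (use m in blast)
  ultimately obtain g where "g \<in> hom G G" "\<forall>(x, y)\<in>R. g x = y"
    using filtered_endo_total by blast
  moreover have "(h, f h) \<in> R" if "h \<in> H" for h
    using memI[OF that D.one_closed] that by simp
  ultimately have "g h = f h" if "h \<in> H" for h using that by fastforce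
  with \<open>g \<in> hom G G\<close> show ?thesis by blast
qed

end

section \<open>Direct sums of subgroups\<close>

lemma (in comm_group) finprod_in_subgroup:
  assumes S: "subgroup S G" and x: "\<And>i. i \<in> J \<Longrightarrow> x i \<in> S"
  shows "(\<Otimes>i\<in>J. x i) \<in> S"
proof -
  interpret S: subgroup S G by fact
  show ?thesis using x
  proof (induction J rule: infinite_finite_induct)
    case (insert i J)
    thus ?case by (simp add: Pi_iff)
  qed simp_all
qed

locale direct_sum_of_subgroups = comm_group G for G :: "('a, 'b) monoid_scheme" (structure) +
  fixes H :: "'a set" and I :: "'i set" and K :: "'i \<Rightarrow> 'a set"
  assumes direct_sum: "internal_direct_sum G H I K"
begin

lemma finite_I: "finite I" and H_subgroup: "subgroup H G"
  and K_subgroup: "i \<in> I \<Longrightarrow> subgroup (K i) G"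
  and bij: "bij_betw (\<lambda>x. \<Otimes>i\<in>I. x i) (\<Pi>\<^sub>E i\<in>I. K i) H"
  using direct_sum by (auto simp: internal_direct_sum_def)

lemma component_in_carrier: "x \<in> (\<Pi>\<^sub>E i\<in>I. K i) \<Longrightarrow> i \<in> I \<Longrightarrow> x i \<in> carrier G"
  using subgroup.subset[OF K_subgroup] by (auto simp: PiE_iff)

lemma finprod_in_H: "x \<in> (\<Pi>\<^sub>E i\<in>I. K i) \<Longrightarrow> (\<Otimes>i\<in>I. x i) \<in> H"
  using bij by (auto simp: bij_betw_def)

lemma decompose:
  assumes "h \<in> H"
  obtains x where "x \<in> (\<Pi>\<^sub>E i\<in>I. K i)" "h = (\<Otimes>i\<in>I. x i)"
  using assms bij by (auto simp: bij_betw_def)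

definition proj :: "'i \<Rightarrow> 'a \<Rightarrow> 'a" where
  "proj i h = inv_into (\<Pi>\<^sub>E i\<in>I. K i) (\<lambda>x. \<Otimes>i\<in>I. x i) h i"

lemma proj_finprod: "x \<in> (\<Pi>\<^sub>E i\<in>I. K i) \<Longrightarrow> proj i (\<Otimes>i\<in>I. x i) = x i"
  unfolding proj_def using inv_into_f_f[OF bij_betw_imp_inj_on[OF bij]] by simp

lemma component:
  assumes "i \<in> I" "k \<in> K i"
  shows "k \<in> H" "proj i k = k"
proof -
  define x where "x = (\<lambda>j\<in>I. if j = i then k else \<one>)"
  have x: "x \<in> (\<Pi>\<^sub>E i\<in>I. K i)"
    using assms subgroup.one_closed[OF K_subgroup] by (auto simp: x_def)
  have k: "k \<in> carrier G" using assms subgroup.mem_carrier[OF K_subgroup] by blast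
  have "(\<Otimes>i\<in>I. x i) = (\<Otimes>j\<in>I. if j = i then k else \<one>)"
    using k by (intro finprod_cong) (auto simp: x_def)
  also have "\<dots> = k"
    using finprod_singleton_swap[OF assms(1) finite_I, of "\<lambda>_. k"] k by simp
  finally have "(\<Otimes>i\<in>I. x i) = k" .
  thus "k \<in> H" "proj i k = k"
    using finprod_in_H[OF x] proj_finprod[OF x, of i] assms(1) by (simp_all add: x_def)
qed

lemma proj_hom:
  assumes i: "i \<in> I"
  shows "proj i \<in> hom (G\<lparr>carrier := H\<rparr>) (G\<lparr>carrier := K i\<rparr>)"
proof (rule homI)
  fix a assume "a \<in> carrier (G\<lparr>carrier := H\<rparr>)"
  then obtain x where "x \<in> (\<Pi>\<^sub>E i\<in>I. K i)" "a = (\<Otimes>i\<in>I. x i)" by (auto elim: decompose)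
  thus "proj i a \<in> carrier (G\<lparr>carrier := K i\<rparr>)" using i by (auto simp: proj_finprod)
next
  fix a b assume "a \<in> carrier (G\<lparr>carrier := H\<rparr>)" "b \<in> carrier (G\<lparr>carrier := H\<rparr>)"
  hence "a \<in> H" "b \<in> H" by simp_all
  obtain x where x: "x \<in> (\<Pi>\<^sub>E i\<in>I. K i)" "a = (\<Otimes>i\<in>I. x i)"
    using \<open>a \<in> H\<close> by (rule decompose)
  obtain y where y: "y \<in> (\<Pi>\<^sub>E i\<in>I. K i)" "b = (\<Otimes>i\<in>I. y i)"
    using \<open>b \<in> H\<close> by (rule decompose)
  define w where "w = (\<lambda>i\<in>I. x i \<otimes> y i)"
  have w: "w \<in> (\<Pi>\<^sub>E i\<in>I. K i)"
    using x(1) y(1) subgroup.m_closed[OF K_subgroup] by (simp add: w_def PiE_iff)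
  have xy: "x \<in> I \<rightarrow> carrier G" "y \<in> I \<rightarrow> carrier G"
    using component_in_carrier x(1) y(1) by auto
  have "(\<Otimes>i\<in>I. w i) = (\<Otimes>i\<in>I. x i \<otimes> y i)"
    using xy by (intro finprod_cong) (auto simp: w_def Pi_iff)
  also have "\<dots> = a \<otimes> b" using x y xy by simp
  finally show "proj i (a \<otimes>\<^bsub>G\<lparr>carrier := H\<rparr>\<^esub> b) = proj i a \<otimes>\<^bsub>G\<lparr>carrier := K i\<rparr>\<^esub> proj i b"
    using proj_finprod[OF w, of i] proj_finprod[OF x(1), of i] proj_finprod[OF y(1), of i] x y i
    by (simp add: w_def)
qed

lemma summand_extension:
  assumes H: "H \<in> extension_subgroups G" and i: "i \<in> I"
  shows "K i \<in> extension_subgroups G"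
  unfolding extension_subgroups_def mem_Collect_eq
proof (intro conjI ballI K_subgroup i)
  fix f assume f: "f \<in> hom (G\<lparr>carrier := K i\<rparr>) G"
  have "f \<circ> proj i \<in> hom (G\<lparr>carrier := H\<rparr>) G"
    using Group.hom_compose[OF proj_hom[OF i] f] .
  then obtain g where g: "g \<in> hom G G" "\<And>x. x \<in> H \<Longrightarrow> g x = f (proj i x)"
    using H by (auto simp: extension_subgroups_def)
  have "g x = f x" if "x \<in> K i" for x
    using g(2)[of x] component[OF i that] by simp
  with g(1) show "\<exists>g\<in>hom G G. \<forall>x\<in>K i. g x = f x" by blast
qed

end

section \<open>Valuated direct sums\<close>

locale primary_direct_sum = primary_comm_group G p + direct_sum_of_subgroups G H I K
  for G :: "('a, 'b) monoid_scheme" (structure) and p :: nat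
    and H :: "'a set" and I :: "'i set" and K :: "'i \<Rightarrow> 'a set"
begin

lemma valuated_direct_sum_iff:
  "valuated_direct_sum p G H I K \<longleftrightarrow>
    (\<forall>x\<in>(\<Pi>\<^sub>E i\<in>I. K i). \<forall>\<sigma>. (\<Otimes>i\<in>I. x i) \<in> ppow p G \<sigma> \<longleftrightarrow> (\<forall>i\<in>I. x i \<in> ppow p G \<sigma>))"
proof -
  have "pheight p G (\<Otimes>i\<in>I. x i) = Min (insert Infty ((\<lambda>i. pheight p G (x i)) ` I)) \<longleftrightarrow>
      (\<forall>\<sigma>. (\<Otimes>i\<in>I. x i) \<in> ppow p G \<sigma> \<longleftrightarrow> (\<forall>i\<in>I. x i \<in> ppow p G \<sigma>))"
    if "x \<in> (\<Pi>\<^sub>E i\<in>I. K i)" for x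
    using component_in_carrier[OF that] by (intro pheight_eq_Min_iff finite_I finprod_closed) auto
  thus ?thesis using direct_sum by (simp add: valuated_direct_sum_def)
qed

text \<open>
  An extension of the projection onto a summand is an endomorphism and so maps every transfinite power
  of \<open>G\<close> to itself. The other inclusion only says that the transfinite powers are subgroups.
\<close>

lemma extension_imp_valuated:
  assumes H: "H \<in> extension_subgroups G"
  shows "valuated_direct_sum p G H I K"
  unfolding valuated_direct_sum_iff
proof (intro ballI allI iffI)
  fix x \<sigma> i assume x: "x \<in> (\<Pi>\<^sub>E i\<in>I. K i)" "(\<Otimes>i\<in>I. x i) \<in> ppow p G \<sigma>" "i \<in> I"
  have "proj i \<in> hom (G\<lparr>carrier := H\<rparr>) G"
    using proj_hom[OF x(3)] subgroup.subset[OF K_subgroup[OF x(3)]] by (auto simp: hom_def)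
  then obtain g where "g \<in> hom G G" "\<And>h. h \<in> H \<Longrightarrow> g h = proj i h"
    using H by (auto simp: extension_subgroups_def)
  thus "x i \<in> ppow p G \<sigma>"
    using hom_ppow[OF _ x(2)] finprod_in_H[OF x(1)] proj_finprod[OF x(1)] by metis
next
  fix x \<sigma> assume "\<forall>i\<in>I. x i \<in> ppow p G \<sigma>"
  thus "(\<Otimes>i\<in>I. x i) \<in> ppow p G \<sigma>"
    by (intro finprod_in_subgroup ppow_subgroup comm_group_axioms) auto
qed

lemma valuated_powers:
  assumes "valuated_direct_sum p G H I K" "x \<in> (\<Pi>\<^sub>E i\<in>I. K i)" "(\<Otimes>i\<in>I. x i) \<in> powers k" "i \<in> I"
  shows "x i \<in> powers k"
  using assms powers_eq_ppow[of k] unfolding valuated_direct_sum_iff by metis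

text \<open>
  The components of \<open>h\<close> are on level \<open>k\<close> because the sum is valuated; on each summand \<open>f\<close> is the
  restriction of an endomorphism and therefore keeps the level.
\<close>

lemma hom_from_valuated_sum_powers:
  assumes K: "\<And>i. i \<in> I \<Longrightarrow> K i \<in> extension_subgroups G"
    and v: "valuated_direct_sum p G H I K"
    and f: "f \<in> hom (G\<lparr>carrier := H\<rparr>) G" and h: "h \<in> H" "h \<in> powers k"
  shows "f h \<in> powers k"
proof -
  interpret H: subgroup H G by (rule H_subgroup)
  interpret S: subgroup "powers k" G by (rule powers_subgroup)
  interpret f: group_hom "G\<lparr>carrier := H\<rparr>" G f
    using f H.subgroup_is_group[OF is_group] is_group
    by (simp add: group_hom_def group_hom_axioms_def)
  obtain x where x: "x \<in> (\<Pi>\<^sub>E i\<in>I. K i)" "h = (\<Otimes>i\<in>I. x i)" using h(1) by (rule decompose)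
  have xH: "x i \<in> H" if "i \<in> I" for i using component(1)[OF that] x(1) that by auto
  have fx: "f (x i) \<in> powers k" if i: "i \<in> I" for i
  proof -
    have xi: "x i \<in> K i" using x(1) i by auto
    have "f \<in> hom (G\<lparr>carrier := K i\<rparr>) G"
      using f component(1)[OF i] by (auto simp: hom_def)
    then obtain g where "g \<in> hom G G" "g (x i) = f (x i)"
      using K[OF i] xi by (auto simp: extension_subgroups_def)
    thus ?thesis using hom_powers valuated_powers[OF v x(1) _ i] h(2) x(2) by metis
  qed
  have "f (\<Otimes>i\<in>J. x i) \<in> powers k" if "finite J" "J \<subseteq> I" for J
    using that
  proof (induction J)
    case empty
    thus ?case using f.hom_one by simp
  next
    case (insert i J)
    have "(\<Otimes>i\<in>J. x i) \<in> H" using insert.prems xH by (intro finprod_in_subgroup H_subgroup) auto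
    hence "f (x i \<otimes> (\<Otimes>i\<in>J. x i)) = f (x i) \<otimes> f (\<Otimes>i\<in>J. x i)"
      using f.hom_mult xH insert.prems by simp
    moreover have "(\<Otimes>i\<in>insert i J. x i) = x i \<otimes> (\<Otimes>i\<in>J. x i)"
      using insert xH by (intro finprod_insert) auto
    ultimately show ?case using insert fx by simp
  qed
  thus ?thesis using finite_I x(2) by simp
qed

end

section \<open>Infinite heights in cyclic subgroups\<close>

lemma (in group) hom_from_cyclic:
  assumes z: "z \<in> carrier G" "K = range (\<lambda>i::int. z [^] i)"
    and y: "y \<in> carrier G" "ord y dvd ord z"
  shows "\<exists>\<phi>\<in>hom (G\<lparr>carrier := K\<rparr>) G. \<phi> z = y"
proof -
  define \<phi> where "\<phi> x = y [^] (SOME i::int. z [^] i = x)" for x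
  have \<phi>: "\<phi> (z [^] i) = y [^] i" for i :: int
  proof -
    define j where "j = (SOME j::int. z [^] j = z [^] i)"
    have "z [^] j = z [^] i" unfolding j_def by (rule someI[of _ i]) simp
    hence "int (ord z) dvd i - j" using int_pow_eq z(1) by blast
    hence "int (ord y) dvd i - j" using y(2) by (meson dvd_trans int_dvd_int_iff)
    hence "y [^] j = y [^] i" using int_pow_eq y(1) by blast
    thus ?thesis by (simp add: \<phi>_def j_def)
  qed
  have "\<phi> \<in> hom (G\<lparr>carrier := K\<rparr>) G"
  proof (rule homI)
    fix a b assume "a \<in> carrier (G\<lparr>carrier := K\<rparr>)" "b \<in> carrier (G\<lparr>carrier := K\<rparr>)"
    then obtain i j :: int where "a = z [^] i" "b = z [^] j" using z(2) by auto
    thus "\<phi> (a \<otimes>\<^bsub>G\<lparr>carrier := K\<rparr>\<^esub> b) = \<phi> a \<otimes> \<phi> b"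
      using z(1) y(1) by (simp add: \<phi> flip: int_pow_mult)
  qed (use z y \<phi> in auto)
  moreover have "\<phi> z = y" using \<phi>[of 1] z(1) y(1) by simp
  ultimately show ?thesis by blast
qed

context primary_comm_group
begin

text \<open>
  The assumption says that the socle of \<open>p\<^sup>m G\<close> consists of elements of infinite height. For \<open>x\<close> in
  \<open>p\<^sup>m G\<close> of order \<open>p\<^sup>n\<^sup>+\<^sup>1\<close>, the socle element \<open>x^(p^n)\<close> is thus also a \<open>p^n\<close>-th power of some element
  of \<open>p\<^sup>m\<^sup>+\<^sup>1 G\<close>, and the quotient of \<open>x\<close> by that element has smaller order.
\<close>

lemma powers_stabilise_if_socle_infinite_height:
  assumes soc: "\<And>y k. y \<in> carrier G \<Longrightarrow> y [^] (p ^ Suc m) = \<one> \<Longrightarrow> y [^] (p ^ m) \<in> powers k"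
  shows "powers (Suc m) = powers m"
proof
  show "powers (Suc m) \<subseteq> powers m" by (rule powers_antimono) simp
  interpret S: subgroup "powers (Suc m)" G by (rule powers_subgroup)
  interpret M: subgroup "powers m" G by (rule powers_subgroup)
  have "x \<in> powers (Suc m)" if "x \<in> powers m" "x [^] (p ^ n) = \<one>" for x n
    using that
  proof (induction n arbitrary: x)
    case 0
    thus ?case by simp
  next
    case (Suc n)
    obtain y where y: "y \<in> carrier G" "x = y [^] (p ^ m)"
      using Suc.prems(1) unfolding powers_def by blast
    have "(y [^] (p ^ n)) [^] (p ^ Suc m) = \<one>" "x [^] (p ^ n) = (y [^] (p ^ n)) [^] (p ^ m)"
      using Suc.prems(2) y by (simp_all add: nat_pow_pow mult_ac)
    hence "x [^] (p ^ n) \<in> powers (Suc m + n)" using soc y(1) by simp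
    then obtain v where v: "v \<in> carrier G" "x [^] (p ^ n) = v [^] (p ^ (Suc m + n))"
      unfolding powers_def by blast
    hence vn: "x [^] (p ^ n) = (v [^] (p ^ Suc m)) [^] (p ^ n)"
      by (simp only: nat_pow_pow power_add)
    define v' where "v' = v [^] (p ^ Suc m)"
    have v': "v' \<in> powers (Suc m)" using v(1) unfolding powers_def v'_def by blast
    hence v'm: "v' \<in> powers m" using powers_antimono[of m "Suc m"] by auto
    have x: "x \<in> carrier G" using Suc.prems(1) by simp
    have "(x \<otimes> inv v') [^] (p ^ n) = \<one>"
      using v(1) vn x v' by (simp add: nat_pow_distrib nat_pow_inv v'_def)
    hence "x \<otimes> inv v' \<in> powers (Suc m)" using Suc.IH Suc.prems(1) v'm by blast
    hence "x \<otimes> inv v' \<otimes> v' \<in> powers (Suc m)" using v' by blast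
    thus ?case using x v' by (simp add: m_assoc)
  qed
  moreover have "\<exists>n. x [^] (p ^ n) = \<one>" if "x \<in> powers m" for x
    using primary pow_ord_eq_1[of x] that by (metis M.mem_carrier p_primary_group_def)
  ultimately show "powers m \<subseteq> powers (Suc m)" by blast
qed

text \<open>
  A nontrivial element of infinite height in \<open>K\<close> generates a subgroup containing the socle of \<open>K\<close>, so
  the socle has infinite height too. Every element \<open>y\<close> whose order divides that of a generator \<open>z\<close> is
  the image of \<open>z\<close> under an endomorphism, which carries the infinite height over to a power of \<open>y\<close>.
\<close>

lemma powers_stabilise_if_infinite_height:
  assumes K: "K \<in> extension_subgroups G" and cyc: "cyclic_group (G\<lparr>carrier := K\<rparr>)"
    and x: "x \<in> K" "x \<noteq> \<one>" "\<And>k. x \<in> powers k"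
  shows "\<exists>m. powers (Suc m) = powers m"
proof -
  have sub: "subgroup K G" using K by (simp add: extension_subgroups_def)
  interpret K: subgroup K G by fact
  obtain z where "z \<in> K" "K = range (\<lambda>i::int. z [^]\<^bsub>G\<lparr>carrier := K\<rparr>\<^esub> i)"
    using cyc unfolding group.cyclic_group[OF K.subgroup_is_group[OF is_group]] by auto
  hence z: "z \<in> K" "K = range (\<lambda>i::int. z [^] i)"
    by (simp_all only: int_pow_consistent[OF sub])
  have zc: "z \<in> carrier G" using z(1) by simp
  obtain r where r: "ord z = p ^ r" using primary zc by (auto simp: p_primary_group_def)
  obtain a :: int where a: "x = z [^] a" using x(1) z(2) by auto
  have "\<not> int (p ^ r) dvd a" using x(2) a r int_pow_eq_id[OF zc] by metis
  obtain u v where uv: "u * a + v * int (p ^ r) = gcd a (int (p ^ r))" using bezout_int by blast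
  have "nat (gcd a (int (p ^ r))) dvd p ^ r"
    by (metis gcd_dvd2 int_dvd_int_iff int_nat_eq gcd_ge_0_int)
  then obtain s where s: "s \<le> r" "nat (gcd a (int (p ^ r))) = p ^ s"
    using divides_primepow_nat[OF prime_p] by blast
  hence g: "gcd a (int (p ^ r)) = int (p ^ s)" by (metis int_nat_eq gcd_ge_0_int)
  \<comment> \<open>The subgroups generated by \<open>x\<close> and by \<open>z^(p^s)\<close> agree, and \<open>s < r\<close> because \<open>x\<close> is nontrivial.\<close>
  have "s \<noteq> r" using \<open>\<not> int (p ^ r) dvd a\<close> g by (metis gcd_dvd1)
  with s obtain t where t: "r = Suc (s + t)" using less_imp_Suc_add by (metis le_neq_implies_less)
  have "z [^] (p ^ s) = z [^] (u * a) \<otimes> z [^] (int (ord z) * v)"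
    using uv zc g r by (simp add: mult.commute flip: int_pow_int int_pow_mult)
  also have "\<dots> = x [^] u"
    using zc int_pow_eq_id[OF zc, of "int (ord z) * v"] by (simp add: a int_pow_pow mult.commute)
  finally have zs: "z [^] (p ^ s) \<in> powers k" for k
    using subgroup_int_pow_closed[OF powers_subgroup x(3)] by simp
  have zst: "z [^] (p ^ (s + t)) \<in> powers k" for k
  proof -
    have "(z [^] (p ^ s)) [^] int (p ^ t) \<in> powers k"
      by (rule subgroup_int_pow_closed[OF powers_subgroup zs])
    thus ?thesis unfolding int_pow_int using zc by (simp add: nat_pow_pow power_add)
  qed
  have "y [^] (p ^ (s + t)) \<in> powers k"
    if y: "y \<in> carrier G" "y [^] (p ^ Suc (s + t)) = \<one>" for y k
  proof -
    have "ord y dvd ord z" using y pow_eq_id r t by metis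
    then obtain \<phi> where \<phi>: "\<phi> \<in> hom (G\<lparr>carrier := K\<rparr>) G" "\<phi> z = y"
      using hom_from_cyclic[OF zc z(2) y(1)] by blast
    then obtain g where g: "g \<in> hom G G" "g z = y"
      using K z(1) by (auto simp: extension_subgroups_def)
    have "g (z [^] (p ^ (s + t))) = y [^] (p ^ (s + t))"
      using hom_nat_pow[OF g(1) zc] is_group g(2) by simp
    thus ?thesis using hom_powers[OF g(1) zst] by metis
  qed
  thus ?thesis using powers_stabilise_if_socle_infinite_height by blast
qed

end

section \<open>Extending homomorphisms from valuated sums of cyclic groups\<close>

context primary_direct_sum
begin

text \<open>
  If \<open>H\<close> met every \<open>p\<^sup>m G\<close> nontrivially, then, being finite, it would contain a single nontrivial
  element of infinite height; its components have infinite height as well, and one of them is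
  nontrivial. The cyclic summand of that component then makes some \<open>p\<^sup>m G\<close> divisible.
\<close>

lemma extension_subgroup_if_valuated:
  assumes fin: "finite H"
    and cyc: "\<And>i. i \<in> I \<Longrightarrow> cyclic_group (G\<lparr>carrier := K i\<rparr>)"
    and K: "\<And>i. i \<in> I \<Longrightarrow> K i \<in> extension_subgroups G"
    and v: "valuated_direct_sum p G H I K"
  shows "H \<in> extension_subgroups G"
proof -
  have one: "\<one> \<in> H \<inter> powers k" for k
    using subgroup.one_closed[OF H_subgroup] subgroup.one_closed[OF powers_subgroup] by blast
  have "\<exists>m. H \<inter> powers m = {\<one>} \<or> powers (Suc m) = powers m"
  proof (cases "\<exists>m. H \<inter> powers m = {\<one>}")
    case False
    hence "\<forall>m. \<exists>h. h \<in> H \<inter> powers m \<and> h \<noteq> \<one>" using one by blast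
    then obtain F where F: "\<And>m. F m \<in> H \<inter> powers m" "\<And>m. F m \<noteq> \<one>" by metis
    have "range F \<subseteq> H" using F by blast
    hence "finite (range F)" using fin by (rule finite_subset)
    then obtain m0 where inf: "infinite {m. F m = F m0}"
      using pigeonhole_infinite[of UNIV F] by auto
    define h where "h = F m0"
    have h: "h \<in> H" "h \<noteq> \<one>" using F by (auto simp: h_def)
    have hk: "h \<in> powers k" for k
    proof -
      obtain m where "k \<le> m" "F m = h" using inf by (auto simp: infinite_nat_iff_unbounded_le h_def)
      thus ?thesis using F(1)[of m] powers_antimono by blast
    qed
    obtain x where x: "x \<in> (\<Pi>\<^sub>E i\<in>I. K i)" "h = (\<Otimes>i\<in>I. x i)" using h(1) by (rule decompose)
    have "(\<Otimes>i\<in>I. x i) \<notin> {\<one>}" using h(2) x(2) by simp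
    then obtain i where i: "i \<in> I" "x i \<noteq> \<one>"
      using finprod_in_subgroup[OF triv_subgroup, of I x] by blast
    have "x i \<in> K i" using x(1) i(1) by auto
    moreover have "x i \<in> powers k" for k using valuated_powers[OF v x(1) _ i(1)] hk x(2) by simp
    ultimately show ?thesis
      using powers_stabilise_if_infinite_height[OF K cyc] i by blast
  qed blast
  then obtain m where m: "H \<inter> powers m = {\<one>} \<or> powers (Suc m) = powers m" by blast
  have "\<exists>g\<in>hom G G. \<forall>x\<in>H. g x = f x" if f: "f \<in> hom (G\<lparr>carrier := H\<rparr>) G" for f
    using filtration_preserving_hom_extends[OF H_subgroup f _ m]
      hom_from_valuated_sum_powers[OF K v f] by blast
  thus ?thesis using H_subgroup by (simp add: extension_subgroups_def)
qed

end

theorem theorem3p4: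
  fixes p n :: nat
    and G :: "('a, 'b) monoid_scheme"
    and H :: "'a set"
    and K :: "nat \<Rightarrow> 'a set"
  assumes "prime p"
    and "comm_group G"
    and "p_primary_group p G"
    and "subgroup H G"
    and "finite H"
    and "internal_direct_sum G H {1..n} K"
    and "\<forall>i\<in>{1..n}. cyclic_group (G\<lparr>carrier := K i\<rparr>)"
  shows "H \<in> extension_subgroups G \<longleftrightarrow>
    (\<forall>i\<in>{1..n}. K i \<in> extension_subgroups G) \<and> valuated_direct_sum p G H {1..n} K"
proof -
  interpret comm_group G by fact
  interpret primary_direct_sum G p H "{1..n}" K
    by unfold_locales (use assms in auto)
  show ?thesis
    using summand_extension extension_imp_valuated extension_subgroup_if_valuated assms by blast
qed

end
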